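(* Let $h:\mathbb{C}_h^{n\times n}\to\mathbb{C}_h^{n\times n}$ be a temporal coherent transformation, i.e. a map of $\mathbb{C}_h^{n\times n}$ onto itself such that (C1) $h(cI)=cI$ for every $c\in\mathbb{N}$; (C2) $h(\mathcal{H}^+)=\mathcal{H}^+$, where $\mathcal{H}^+=\{G\in\mathbb{C}_h^{n\times n}\mid G\gneq 0\}$; (C3) $h(\alpha G_1+\beta G_2)=\alpha h(G_1)+\beta h(G_2)$ for all $G_1,G_2\in\mathbb{C}_h^{n\times n}$ and all reals $\alpha,\beta>0$. Then there is a unitary or anti-unitary operator $U$ on $\mathbb{C}^n$, unique up to a phase, such that $h(G)=U^\dagger GU$ for every $G\in\mathbb{C}_h^{n\times n}$. Moreover, if $\mathcal{K}\subseteq\mathbb{C}_h^{n\times n}$ is a coherent set of strictly desirable gambles (SDG), then $\mathcal{K}'=\{G\in\mathbb{C}_h^{n\times n}\mid U^\dagger GU\in\mathcal{K}\}$ is an SDG too.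
   Context: $\mathbb{C}_h^{n\times n}$ is the real vector space of $n\times n$ complex Hermitian matrices, identified with self-adjoint operators on $\mathbb{C}^n$. For $G\in\mathbb{C}_h^{n\times n}$: $G\gneq 0$ means $G$ is positive semi-definite and $G\ne 0$; $G>0$ means positive definite; $I$ is the identity matrix. An anti-unitary operator on $\mathbb{C}^n$ is a conjugate-linear bijection $U$ with $\langle Ux,Uy\rangle=\overline{\langle x,y\rangle}$, and $U^\dagger=U^{-1}$ is its (conjugate-linear) adjoint; equivalently, the maps $G\mapsto U^\dagger GU$ with $U$ anti-unitary are the maps $G\mapsto W^\dagger G^{T}W$ with $W$ a unitary matrix and $G^T$ the transpose of $G$. A set $\mathcal{K}\subseteq\mathbb{C}_h^{n\times n}$ is a coherent set of strictly desirable gambles (SDG) if: (S1) $\mathcal{K}$ is a non-pointed convex cone, i.e. closed under addition and under multiplication by reals $\nu>0$, and $0\notin\mathcal{K}$; (S2) every $G\gneq 0$ belongs to $\mathcal{K}$; (S3) if $G\in\mathcal{K}$ then either $G\gneq 0$ or $G-\Delta\in\mathcal{K}$ for some $\Delta\in\mathbb{C}_h^{n\times n}$ with $\Delta>0$.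
   Formalization: For n = 1 the identity and complex conjugation both give h and do not differ by a phase, so there "unique up to a phase" is claimed only among unitary operators and among anti-unitary operators separately; for n ≥ 2 it is claimed among all of them. *)

theory Defs
  imports "HOL-Analysis.Analysis"
begin

definition cinner :: "complex^'n \<Rightarrow> complex^'n \<Rightarrow> complex" where
  "cinner x y = (\<Sum>i\<in>UNIV. cnj (x $ i) * y $ i)"

definition hermitians :: "(complex^'n^'n) set" where
  "hermitians = {G. \<forall>i j. G $ i $ j = cnj (G $ j $ i)}"

text \<open>For Hermitian \<open>G\<close> the number \<open>cinner x (G *v x)\<close> is real; \<open>Re\<close> is only a coercion.\<close>

definition pos_semidef :: "complex^'n^'n \<Rightarrow> bool" where
  "pos_semidef G \<longleftrightarrow> G \<in> hermitians \<and> (\<forall>x. 0 \<le> Re (cinner x (G *v x)))"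

definition pos_def :: "complex^'n^'n \<Rightarrow> bool" where
  "pos_def G \<longleftrightarrow> G \<in> hermitians \<and> (\<forall>x. x \<noteq> 0 \<longrightarrow> 0 < Re (cinner x (G *v x)))"

definition Hplus :: "(complex^'n^'n) set" where
  "Hplus = {G. pos_semidef G \<and> G \<noteq> 0}"

definition unitary_op :: "(complex^'n \<Rightarrow> complex^'n) \<Rightarrow> bool" where
  "unitary_op U \<longleftrightarrow> Vector_Spaces.linear (*s) (*s) U \<and> bij U \<and>
     (\<forall>x y. cinner (U x) (U y) = cinner x y)"

definition conj_linear :: "(complex^'n \<Rightarrow> complex^'n) \<Rightarrow> bool" where
  "conj_linear U \<longleftrightarrow> (\<forall>x y. U (x + y) = U x + U y) \<and> (\<forall>c x. U (c *s x) = cnj c *s U x)"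

definition antiunitary_op :: "(complex^'n \<Rightarrow> complex^'n) \<Rightarrow> bool" where
  "antiunitary_op U \<longleftrightarrow> conj_linear U \<and> bij U \<and>
     (\<forall>x y. cinner (U x) (U y) = cnj (cinner x y))"

text \<open>The matrix of the operator \<open>U\<^sup>\<dagger> G U\<close>. The adjoint of a unitary or anti-unitary operator
  is its inverse (\<open>unitary_op_adjoint\<close>, \<open>antiunitary_op_adjoint\<close>), and the composite is
  complex-linear in both cases (\<open>dagger_conj_mult_vec\<close>).\<close>

definition dagger_conj :: "(complex^'n \<Rightarrow> complex^'n) \<Rightarrow> complex^'n^'n \<Rightarrow> complex^'n^'n" where
  "dagger_conj U G = matrix (\<lambda>x. inv U (G *v U x))"

lemma unitary_op_adjoint:
  assumes "unitary_op U"
  shows "cinner (inv U x) y = cinner x (U y)"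
  using assms unfolding unitary_op_def by (metis bij_inv_eq_iff)

lemma antiunitary_op_adjoint:
  assumes "antiunitary_op U"
  shows "cinner (inv U x) y = cnj (cinner x (U y))"
  using assms unfolding antiunitary_op_def by (metis bij_inv_eq_iff complex_cnj_cnj)

lemma dagger_conj_mult_vec:
  assumes "unitary_op U \<or> antiunitary_op U"
  shows "dagger_conj U G *v x = inv U (G *v U x)"
proof -
  have "bij U" and add: "\<And>x y. U (x + y) = U x + U y"
    using assms by (auto simp: unitary_op_def antiunitary_op_def conj_linear_def
        Vector_Spaces.linear_iff)
  hence 1: "inv U (a + b) = inv U a + inv U b" for a b
    by (metis bij_inv_eq_iff)
  have 2: "inv U (G *v U (c *s x)) = c *s inv U (G *v U x)" for c x
    using assms
  proof
    assume "unitary_op U"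
    hence s: "U (c *s x) = c *s U x" for c x
      by (auto simp: unitary_op_def Vector_Spaces.linear_iff)
    show ?thesis
      unfolding s vector_scalar_commute
      using \<open>bij U\<close> by (metis bij_inv_eq_iff s)
  next
    assume "antiunitary_op U"
    hence s: "U (c *s x) = cnj c *s U x" for c x
      by (auto simp: antiunitary_op_def conj_linear_def)
    show ?thesis
      unfolding s vector_scalar_commute
      using \<open>bij U\<close> by (metis bij_inv_eq_iff s)
  qed
  have "Vector_Spaces.linear (*s) (*s) (\<lambda>x. inv U (G *v U x))"
    unfolding Vector_Spaces.linear_iff
    by (auto simp: vec.vector_space_axioms add 1 2 matrix_vector_right_distrib)
  thus ?thesis
    unfolding dagger_conj_def by (rule matrix_works)
qed

text \<open>\<open>h\<close> is a map of the Hermitian matrices; its values elsewhere are irrelevant.\<close>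

definition temporal_coherent :: "(complex^'n^'n \<Rightarrow> complex^'n^'n) \<Rightarrow> bool" where
  "temporal_coherent h \<longleftrightarrow>
     h ` hermitians = hermitians \<and>
     (\<forall>c::nat. h (real c *\<^sub>R mat 1) = real c *\<^sub>R mat 1) \<and>
     h ` Hplus = Hplus \<and>
     (\<forall>G1\<in>hermitians. \<forall>G2\<in>hermitians. \<forall>\<alpha> \<beta>. 0 < \<alpha> \<longrightarrow> 0 < \<beta> \<longrightarrow>
        h (\<alpha> *\<^sub>R G1 + \<beta> *\<^sub>R G2) = \<alpha> *\<^sub>R h G1 + \<beta> *\<^sub>R h G2)"

definition SDG :: "(complex^'n^'n) set \<Rightarrow> bool" where
  "SDG K \<longleftrightarrow> K \<subseteq> hermitians \<and>
     (\<forall>G1\<in>K. \<forall>G2\<in>K. G1 + G2 \<in> K) \<and>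
     (\<forall>G\<in>K. \<forall>\<nu>>0. \<nu> *\<^sub>R G \<in> K) \<and>
     0 \<notin> K \<and>
     Hplus \<subseteq> K \<and>
     (\<forall>G\<in>K. G \<in> Hplus \<or> (\<exists>\<Delta>. pos_def \<Delta> \<and> G - \<Delta> \<in> K))"

text \<open>If \<open>n = 1\<close>, the identity and complex conjugation both satisfy \<open>U\<^sup>\<dagger> G U = G\<close> for every
  Hermitian \<open>G\<close>, and do not differ by a phase. In that dimension alone, uniqueness up to a phase
  is claimed only among the unitary operators and among the anti-unitary operators separately.\<close>

definition unique_up_to_phase ::
  "(complex^'n^'n \<Rightarrow> complex^'n^'n) \<Rightarrow> (complex^'n \<Rightarrow> complex^'n) \<Rightarrow> bool" where
  "unique_up_to_phase h U \<longleftrightarrow>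
     (\<forall>V. (unitary_op V \<or> antiunitary_op V) \<and>
          (\<forall>G\<in>hermitians. h G = dagger_conj V G) \<and>
          (CARD('n) = 1 \<longrightarrow> (unitary_op V \<longleftrightarrow> unitary_op U)) \<longrightarrow>
          (\<exists>c. cmod c = 1 \<and> (\<forall>x. V x = c *s U x)))"

end

theory Submission
  imports Defs
begin

text \<open>Restricted to the Hermitian matrices, \<open>h\<close> is a unital linear automorphism of the cone of positive
  semidefinite matrices. The extreme rays of that cone are spanned by the matrices \<open>x x\<^sup>*\<close>, so \<open>h\<close>
  permutes them. As \<open>h\<close> is unital, it sends the \<open>e\<^sub>i e\<^sub>i\<^sup>*\<close> to \<open>f\<^sub>i f\<^sub>i\<^sup>*\<close> for an orthonormal basis
  \<open>f\<^sub>i\<close>, and after composing with a unitary conjugation one may assume that \<open>h\<close> fixes each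
  \<open>e\<^sub>i e\<^sub>i\<^sup>*\<close>. Then \<open>h\<close> preserves the diagonal of \<open>x x\<^sup>*\<close>, hence acts entrywise, by real-linear isometries
  \<open>\<phi>\<^sub>i\<^sub>j\<close> of the complex plane: \<open>\<phi>\<^sub>i\<^sub>j(z)\<close> is \<open>u\<^sub>i\<^sub>j z\<close> or \<open>u\<^sub>i\<^sub>j\<close> times the conjugate of \<open>z\<close>. The images of
  \<open>x x\<^sup>*\<close> with \<open>|x\<^sub>i| = 1\<close> having rank one yields \<open>u\<^sub>i\<^sub>j u\<^sub>j\<^sub>k = u\<^sub>i\<^sub>k\<close> and that the same alternative
  occurs for all \<open>i \<noteq> j\<close>. So \<open>h\<close> is conjugation by a diagonal unitary, possibly after entrywise
  complex conjugation. For uniqueness, \<open>V U\<^sup>\<dagger>\<close> has every vector as an eigenvector.\<close>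

section \<open>Inner product, Hermitian matrices and Cauchy-Schwarz\<close>

abbreviation unit_vec :: "'n \<Rightarrow> complex^'n" where
  "unit_vec i \<equiv> axis i 1"

lemma cinner_add_left: "cinner (x + y) z = cinner x z + cinner y z"
  by (simp add: cinner_def algebra_simps sum.distrib)

lemma cinner_add_right: "cinner x (y + z) = cinner x y + cinner x z"
  by (simp add: cinner_def algebra_simps sum.distrib)

lemma cinner_diff_right: "cinner x (y - z) = cinner x y - cinner x z"
  by (simp add: cinner_def algebra_simps sum_subtractf)

lemma cinner_minus_right [simp]: "cinner x (- y) = - cinner x y"
  by (simp add: cinner_def sum_negf)

lemma cinner_scale_left: "cinner (c *s x) y = cnj c * cinner x y"
  by (simp add: cinner_def sum_distrib_left mult.assoc)

lemma cinner_scale_right: "cinner x (c *s y) = c * cinner x y"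
  by (simp add: cinner_def sum_distrib_left mult.left_commute)

lemma cinner_scaleR_right: "cinner x (r *\<^sub>R y) = of_real r * cinner x y"
  by (simp add: cinner_def sum_distrib_left scaleR_conv_of_real[where 'a=complex] mult.left_commute)

lemma cinner_scaleR_left: "cinner (r *\<^sub>R x) y = of_real r * cinner x y"
  by (simp add: cinner_def sum_distrib_left scaleR_conv_of_real[where 'a=complex] mult.assoc)

lemma cinner_zero_right [simp]: "cinner x 0 = 0"
  by (simp add: cinner_def)

lemma cinner_zero_left [simp]: "cinner 0 x = 0"
  by (simp add: cinner_def)

lemma cnj_cinner: "cnj (cinner x y) = cinner y x"
  by (simp add: cinner_def mult.commute)

lemma cmod_square: "(complex_of_real (cmod z))\<^sup>2 = z * cnj z"
  by (metis complex_norm_square of_real_power)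

lemma cinner_self: "cinner x x = of_real (\<Sum>i\<in>UNIV. (cmod (x $ i))\<^sup>2)"
  unfolding cinner_def by (simp add: cmod_square mult.commute)

lemma cinner_self_eq_0_iff [simp]: "cinner x x = 0 \<longleftrightarrow> x = 0"
  unfolding cinner_self of_real_eq_0_iff
  by (subst sum_nonneg_eq_0_iff) (auto simp: vec_eq_iff)

lemma cinner_unit_vec_left [simp]: "cinner (unit_vec i) x = x $ i"
proof -
  have "cinner (unit_vec i) x = (\<Sum>j\<in>UNIV. if j = i then x $ j else 0)"
    unfolding cinner_def axis_def by (intro sum.cong) auto
  thus ?thesis by simp
qed

lemma cinner_unit_vec_right [simp]: "cinner x (unit_vec i) = cnj (x $ i)"
  by (metis cnj_cinner cinner_unit_vec_left)

lemma cinner_ext: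
  assumes "\<And>z. cinner z x = cinner z y"
  shows "x = y"
  using assms[of "unit_vec _"] by (simp add: vec_eq_iff)

lemma matrix_mult_unit_vec_nth: "(A *v unit_vec j) $ i = (A :: complex^'n^'m) $ i $ j"
  by (simp add: matrix_vector_mult_def axis_def if_distrib cong: if_cong)

lemma cinner_unit_vec_matrix: "cinner (unit_vec i) (A *v unit_vec j) = A $ i $ j"
  by (simp add: matrix_mult_unit_vec_nth)

lemma scaleR_matrix_mult: "(r *\<^sub>R A) *v x = r *\<^sub>R (A *v (x :: complex^'n))"
  by (simp add: vec_eq_iff matrix_vector_mult_def scaleR_right.sum)

lemma hermitian_cinner:
  assumes "G \<in> hermitians"
  shows "cinner (G *v x) y = cinner x (G *v y)"
proof -
  have G: "cnj (G $ i $ j) = G $ j $ i" for i j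
    using assms unfolding hermitians_def by (metis (mono_tags, lifting) complex_cnj_cnj mem_Collect_eq)
  have "cinner (G *v x) y = (\<Sum>i\<in>UNIV. \<Sum>j\<in>UNIV. G $ j $ i * cnj (x $ j) * y $ i)"
    by (simp add: cinner_def matrix_vector_mult_def sum_distrib_right G)
  also have "\<dots> = cinner x (G *v y)"
    by (subst sum.swap) (simp add: cinner_def matrix_vector_mult_def sum_distrib_left mult_ac)
  finally show ?thesis .
qed

lemma hermitians_iff: "G \<in> hermitians \<longleftrightarrow> (\<forall>x y. cinner (G *v x) y = cinner x (G *v y))"
proof
  assume *: "\<forall>x y. cinner (G *v x) y = cinner x (G *v y)"
  have "cnj (cinner (unit_vec j) (G *v unit_vec i)) = cinner (unit_vec i) (G *v unit_vec j)" for i j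
    using * by (simp only: cnj_cinner)
  thus "G \<in> hermitians"
    unfolding hermitians_def cinner_unit_vec_matrix by simp
qed (use hermitian_cinner in blast)

lemma subspace_hermitians: "subspace hermitians"
  unfolding subspace_def hermitians_iff
  by (auto simp: hermitian_cinner matrix_vector_mult_add_rdistrib scaleR_matrix_mult cinner_add_left
      cinner_add_right cinner_scaleR_left cinner_scaleR_right)

lemma hermitians_mat1: "mat 1 \<in> hermitians"
  by (auto simp: hermitians_def mat_def)

text \<open>The discriminant argument, applied to \<open>t \<mapsto> \<langle>v - t c x, P (v - t c x)\<rangle>\<close>
  with \<open>c = \<langle>x, P v\<rangle>\<close>.\<close>

lemma pos_semidef_Cauchy_Schwarz:
  assumes "pos_semidef P"
  shows "(cmod (cinner v (P *v x)))\<^sup>2 \<le> Re (cinner v (P *v v)) * Re (cinner x (P *v x))"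
proof -
  define b where "b = cinner v (P *v x)"
  define p q where "p = Re (cinner v (P *v v))" and "q = Re (cinner x (P *v x))"
  have herm: "P \<in> hermitians" and pos: "0 \<le> Re (cinner y (P *v y))" for y
    using assms by (auto simp: pos_semidef_def)
  have b': "cinner x (P *v v) = cnj b"
    unfolding b_def cnj_cinner hermitian_cinner[OF herm] ..
  have quad: "0 \<le> p - 2 * t * (cmod b)\<^sup>2 + t\<^sup>2 * (cmod b)\<^sup>2 * q" for t :: real
  proof -
    define c where "c = - of_real t * cnj b"
    have "cinner (v + c *s x) (P *v (v + c *s x)) =
        cinner v (P *v v) + c * b + cnj c * cnj b + cnj c * c * cinner x (P *v x)"
      by (simp add: matrix_vector_right_distrib cinner_add_left cinner_add_right
          vector_scalar_commute cinner_scale_left cinner_scale_right b' b_def algebra_simps)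
    also have "c * b = - of_real (t * (cmod b)\<^sup>2)"
      unfolding c_def using complex_norm_square[of b] by (simp add: mult_ac)
    also have "cnj c * cnj b = - of_real (t * (cmod b)\<^sup>2)"
      unfolding c_def using complex_norm_square[of b] by (simp add: mult_ac)
    also have "cnj c * c = of_real (t\<^sup>2 * (cmod b)\<^sup>2)"
      unfolding c_def using complex_norm_square[of b] by (simp add: mult_ac power2_eq_square)
    finally show ?thesis
      using pos[of "v + c *s x"] by (simp add: p_def q_def)
  qed
  have "(cmod b)\<^sup>2 \<le> p * q"
  proof (cases "q = 0")
    case True
    have "cmod b = 0"
    proof (rule ccontr)
      assume b: "cmod b \<noteq> 0"
      \<comment> \<open>With \<open>q = 0\<close> the quadratic is linear in \<open>t\<close>, and
        this \<open>t\<close> would give it the value -1.\<close>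
      hence "(p + 1) / (2 * (cmod b)\<^sup>2) * (2 * (cmod b)\<^sup>2) = p + 1"
        by simp
      with quad[of "(p + 1) / (2 * (cmod b)\<^sup>2)"] True b pos[of v] show False
        by (simp add: p_def)
    qed
    thus ?thesis using True by simp
  next
    case False
    hence "q > 0" using pos[of x] by (simp add: q_def)
    \<comment> \<open>The quadratic is minimal at \<open>t = 1/q\<close>; the factor
      \<open>q\<close> clears denominators.\<close>
    have "0 \<le> (p - 2 * (1/q) * (cmod b)\<^sup>2 + (1/q)\<^sup>2 * (cmod b)\<^sup>2 * q) * q"
      by (rule mult_nonneg_nonneg[OF quad]) (use \<open>q > 0\<close> in simp)
    also have "\<dots> = p * q - (cmod b)\<^sup>2"
      using \<open>q > 0\<close> by (simp add: field_simps power2_eq_square)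
    finally show ?thesis by simp
  qed
  thus ?thesis by (simp add: b_def p_def q_def)
qed

text \<open>In Cauchy-Schwarz with \<open>v = P *v x\<close> the right-hand side is 0 and the
  left-hand side is the fourth power of the norm of \<open>P *v x\<close>.\<close>

lemma pos_semidef_kernel:
  assumes "pos_semidef P" "Re (cinner x (P *v x)) = 0"
  shows "P *v x = 0"
  using pos_semidef_Cauchy_Schwarz[OF assms(1), of "P *v x" x] assms(2) by simp

section \<open>Rank-one matrices as extreme rays\<close>

definition outer :: "complex^'n \<Rightarrow> complex^'n^'n" where
  "outer x = (\<chi> i j. x $ i * cnj (x $ j))"

lemma outer_nth [simp]: "outer x $ i $ j = x $ i * cnj (x $ j)"
  by (simp add: outer_def)

lemma outer_mult_vec: "outer x *v y = cinner x y *s x"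
  by (simp add: vec_eq_iff matrix_vector_mult_def cinner_def sum_distrib_left mult_ac)

lemma outer_scale: "outer (c *s x) = (cmod c)\<^sup>2 *\<^sub>R outer x"
  by (simp add: vec_eq_iff scaleR_conv_of_real[where 'a=complex] cmod_square mult_ac)

lemma outer_eq_0_iff [simp]: "outer x = 0 \<longleftrightarrow> x = 0"
  by (auto simp: vec_eq_iff)

lemma cinner_outer: "cinner y (outer x *v y) = of_real ((cmod (cinner x y))\<^sup>2)"
  unfolding outer_mult_vec cinner_scale_right complex_norm_square cnj_cinner ..

lemma outer_hermitian: "outer x \<in> hermitians"
  by (simp add: hermitians_def)

lemma pos_semidef_outer: "pos_semidef (outer x)"
  by (auto simp: pos_semidef_def cinner_outer outer_hermitian simp del: of_real_power)

text \<open>By Cauchy--Schwarz, \<open>(P x)(P x)\<^sup>* / \<langle>x, P x\<rangle> \<le> P\<close> whenever \<open>P x \<noteq> 0\<close>.\<close>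

lemma pos_semidef_extreme_imp_outer:
  assumes P: "pos_semidef P"
    and extreme: "\<And>Q. pos_semidef Q \<Longrightarrow> pos_semidef (P - Q) \<Longrightarrow> \<exists>c. Q = c *\<^sub>R P"
  obtains y where "P = outer y"
proof (cases "P = 0")
  case True
  thus ?thesis using that[of 0] by simp
next
  case False
  then obtain x where x: "P *v x \<noteq> 0"
    by (metis matrix_eq matrix_vector_mult_0)
  define a where "a = Re (cinner x (P *v x))"
  define y where "y = of_real (1 / sqrt a) *s (P *v x)"
  have herm: "P \<in> hermitians" and pos: "0 \<le> Re (cinner y (P *v y))" for y
    using P by (auto simp: pos_semidef_def)
  have "a > 0"
    using pos_semidef_kernel[OF P, of x] x pos[of x] by (fastforce simp: a_def)
  have form: "cinner v (outer y *v v) = of_real ((cmod (cinner v (P *v x)))\<^sup>2 / a)" for v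
  proof -
    have "cmod (cinner y v) = cmod (cinner v (P *v x)) / sqrt a"
      using \<open>a > 0\<close> unfolding y_def cinner_scale_left norm_mult
      by (simp add: norm_divide) (metis cnj_cinner complex_mod_cnj)
    thus ?thesis using \<open>a > 0\<close> unfolding cinner_outer by (simp add: power_divide)
  qed
  have "pos_semidef (P - outer y)"
    unfolding pos_semidef_def
  proof (intro conjI allI)
    show "P - outer y \<in> hermitians"
      using herm pos_semidef_outer[of y] subspace_diff[OF subspace_hermitians]
      by (auto simp: pos_semidef_def)
    fix v
    have "(cmod (cinner v (P *v x)))\<^sup>2 / a \<le> Re (cinner v (P *v v))"
      using pos_semidef_Cauchy_Schwarz[OF P, of v x] \<open>a > 0\<close> by (simp add: a_def field_simps)
    thus "0 \<le> Re (cinner v ((P - outer y) *v v))"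
      by (simp add: matrix_vector_mult_diff_rdistrib cinner_diff_right form del: of_real_divide)
  qed
  from extreme[OF pos_semidef_outer this] obtain c where c: "outer y = c *\<^sub>R P" ..
  \<comment> \<open>At \<open>x\<close> the quadratic forms of \<open>outer y\<close> and of
    \<open>c *\<^sub>R P\<close> take the values \<open>a\<close> and \<open>c * a\<close>, which
    forces \<open>c = 1\<close>.\<close>
  have real: "cinner x (P *v x) = of_real a"
    unfolding a_def by (metis Reals_cnj_iff cnj_cinner herm hermitian_cinner of_real_Re)
  have "cinner x (outer y *v x) = of_real a"
    unfolding form real using \<open>a > 0\<close> by (simp add: power2_eq_square)
  moreover have "cinner x (outer y *v x) = of_real (c * a)"
    unfolding c scaleR_matrix_mult cinner_scaleR_right real by simp
  ultimately have "c = 1"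
    using \<open>a > 0\<close> by (metis mult_cancel_right1 of_real_eq_iff order_less_irrefl)
  thus ?thesis using that[of y] c by simp
qed

text \<open>\<open>Q\<close> is squeezed to 0 on the orthogonal complement of \<open>y\<close>, so
  its range lies in the span of \<open>Q *v y\<close>; self-adjointness makes that vector a multiple
  of \<open>y\<close>.\<close>

lemma pos_semidef_le_outer:
  assumes Q: "pos_semidef Q" and le: "pos_semidef (outer y - Q)"
  obtains c :: real where "Q = c *\<^sub>R outer y"
proof (cases "y = 0")
  case True
  have "Q *v v = 0" for v
    using Q le True
    by (intro pos_semidef_kernel)
      (auto simp: pos_semidef_def matrix_vector_mult_diff_rdistrib cinner_diff_right
        outer_mult_vec intro: antisym)
  hence "Q = 0" by (simp add: matrix_eq)
  thus ?thesis using that[of 0] by simp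
next
  case False
  have herm: "Q \<in> hermitians"
    using Q by (auto simp: pos_semidef_def)
  define n where "n = cinner y y"
  have n: "n \<noteq> 0" "cnj n = n"
    using False by (simp_all add: n_def cnj_cinner)
  define w where "w = Q *v y"
  have ker: "Q *v v = 0" if "cinner y v = 0" for v
  proof (rule pos_semidef_kernel[OF Q], rule antisym)
    have "0 \<le> Re (cinner v ((outer y - Q) *v v))"
      using le by (simp add: pos_semidef_def)
    thus "Re (cinner v (Q *v v)) \<le> 0"
      using that by (simp add: matrix_vector_mult_diff_rdistrib cinner_diff_right outer_mult_vec)
  qed (use Q in \<open>simp add: pos_semidef_def\<close>)
  have Qv: "Q *v v = (cinner y v / n) *s w" for v
  proof -
    have "Q *v (v - (cinner y v / n) *s y) = 0"
      by (rule ker) (use n in \<open>simp add: cinner_diff_right cinner_scale_right flip: n_def\<close>)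
    thus ?thesis
      by (simp add: matrix_vector_mult_diff_distrib vector_scalar_commute w_def)
  qed
  have w: "w = (cinner w y / n) *s y"
  proof (rule cinner_ext)
    fix z
    have "cinner z w = cnj (cinner y (Q *v z))"
      by (metis cnj_cinner herm hermitian_cinner w_def)
    also have "\<dots> = cnj (cinner y z / n * cinner y w)"
      by (simp only: Qv cinner_scale_right)
    also have "\<dots> = cinner z ((cinner w y / n) *s y)"
      using n by (simp add: cnj_cinner cinner_scale_right mult_ac)
    finally show "cinner z w = cinner z ((cinner w y / n) *s y)" .
  qed
  define c where "c = cinner w y / n / n"
  have "cnj (cinner w y) = cinner w y"
    by (metis cnj_cinner herm hermitian_cinner w_def)
  hence "cnj c = c" using n by (simp add: c_def)
  then obtain r where r: "c = of_real r"
    by (metis Reals_cnj_iff Reals_cases)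
  have "Q *v v = (r *\<^sub>R outer y) *v v" for v
  proof -
    have "Q *v v = (cinner y v / n) *s ((cinner w y / n) *s y)"
      using Qv[of v] w by simp
    also have "\<dots> = c *s (cinner y v *s y)"
      by (simp add: c_def vector_smult_assoc mult_ac)
    also have "\<dots> = (r *\<^sub>R outer y) *v v"
      unfolding scaleR_matrix_mult outer_mult_vec r
      by (simp add: vec_eq_iff scaleR_conv_of_real[where 'a=complex])
    finally show ?thesis .
  qed
  thus ?thesis using that by (metis matrix_eq)
qed

section \<open>Conjugation by unitary and anti-unitary operators\<close>

text \<open>Both kinds are real-linear bijections preserving the real part of the inner product, so
  most facts about conjugation can be proved for them together.\<close>

definition isometric_op :: "(complex^'n \<Rightarrow> complex^'n) \<Rightarrow> bool" where
  "isometric_op U \<longleftrightarrow> unitary_op U \<or> antiunitary_op U"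

lemma unitary_op_scale: "unitary_op U \<Longrightarrow> U (c *s x) = c *s U x"
  by (simp add: unitary_op_def Vector_Spaces.linear_iff)

lemma antiunitary_op_scale: "antiunitary_op U \<Longrightarrow> U (c *s x) = cnj c *s U x"
  by (simp add: antiunitary_op_def conj_linear_def)

lemma isometric_op_bij: "isometric_op U \<Longrightarrow> bij U"
  by (auto simp: isometric_op_def unitary_op_def antiunitary_op_def)

lemma isometric_op_inv_right [simp]: "isometric_op U \<Longrightarrow> U (inv U x) = x"
  by (simp add: isometric_op_bij bij_is_surj surj_f_inv_f)

lemma isometric_op_inv_left [simp]: "isometric_op U \<Longrightarrow> inv U (U x) = x"
  by (simp add: isometric_op_bij bij_is_inj)

lemma isometric_op_add: "isometric_op U \<Longrightarrow> U (x + y) = U x + U y"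
  by (auto simp: isometric_op_def unitary_op_def antiunitary_op_def conj_linear_def
      Vector_Spaces.linear_iff)

lemma scaleR_vec_eq: "r *\<^sub>R x = of_real r *s (x :: complex^'n)"
  by (simp add: vec_eq_iff scaleR_conv_of_real[where 'a=complex])

lemma isometric_op_scaleR: "isometric_op U \<Longrightarrow> U (r *\<^sub>R x) = r *\<^sub>R U x"
  by (auto simp: isometric_op_def scaleR_vec_eq unitary_op_scale antiunitary_op_scale)

lemma isometric_op_Re_cinner: "isometric_op U \<Longrightarrow> Re (cinner (U x) (U y)) = Re (cinner x y)"
  by (auto simp: isometric_op_def unitary_op_def antiunitary_op_def)

lemma unitary_opI:
  assumes "\<And>x y. U (x + y) = U x + U y" "\<And>c x. U (c *s x) = c *s U x" "bij U"
    "\<And>x y. cinner (U x) (U y) = cinner x y"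
  shows "unitary_op U"
  using assms unfolding unitary_op_def Vector_Spaces.linear_iff
  by (simp add: vec.vector_space_axioms)

lemma antiunitary_opI:
  assumes "\<And>x y. U (x + y) = U x + U y" "\<And>c x. U (c *s x) = cnj c *s U x" "bij U"
    "\<And>x y. cinner (U x) (U y) = cnj (cinner x y)"
  shows "antiunitary_op U"
  using assms by (simp add: antiunitary_op_def conj_linear_def)

lemma unitary_op_inv:
  assumes "unitary_op U"
  shows "unitary_op (inv U)"
proof -
  have U: "isometric_op U" using assms by (simp add: isometric_op_def)
  show ?thesis
  proof (rule unitary_opI)
    show "inv U (x + y) = inv U x + inv U y" for x y
      using isometric_op_inv_left[OF U, of "inv U x + inv U y"] U
      by (simp add: isometric_op_add)
    show "inv U (c *s x) = c *s inv U x" for c x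
      using isometric_op_inv_left[OF U, of "c *s inv U x"] U
      by (simp add: unitary_op_scale[OF assms])
    show "bij (inv U)" using U by (simp add: isometric_op_bij bij_imp_bij_inv)
    show "cinner (inv U x) (inv U y) = cinner x y" for x y
      using U assms by (metis unitary_op_def isometric_op_inv_right)
  qed
qed

lemma antiunitary_op_inv:
  assumes "antiunitary_op U"
  shows "antiunitary_op (inv U)"
proof -
  have U: "isometric_op U" using assms by (simp add: isometric_op_def)
  show ?thesis
  proof (rule antiunitary_opI)
    show "inv U (x + y) = inv U x + inv U y" for x y
      using isometric_op_inv_left[OF U, of "inv U x + inv U y"] U
      by (simp add: isometric_op_add)
    show "inv U (c *s x) = cnj c *s inv U x" for c x
      using isometric_op_inv_left[OF U, of "cnj c *s inv U x"] U
      by (simp add: antiunitary_op_scale[OF assms])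
    show "bij (inv U)" using U by (simp add: isometric_op_bij bij_imp_bij_inv)
    show "cinner (inv U x) (inv U y) = cnj (cinner x y)" for x y
      using U assms by (metis antiunitary_op_def isometric_op_inv_right complex_cnj_cnj)
  qed
qed

lemma isometric_op_inv: "isometric_op U \<Longrightarrow> isometric_op (inv U)"
  by (auto simp: isometric_op_def unitary_op_inv antiunitary_op_inv)

lemma isometric_op_comp:
  assumes U: "isometric_op U" and V: "isometric_op V"
  shows "isometric_op (U \<circ> V)"
proof -
  have add: "(U \<circ> V) (x + y) = (U \<circ> V) x + (U \<circ> V) y" for x y
    by (simp add: isometric_op_add U V)
  have bij: "bij (U \<circ> V)"
    using U V by (simp add: isometric_op_bij bij_comp)
  show ?thesis
  proof (cases "unitary_op U \<longleftrightarrow> unitary_op V")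
    case True
    have "unitary_op (U \<circ> V)"
    proof (rule unitary_opI[OF add _ bij])
      show "(U \<circ> V) (c *s x) = c *s (U \<circ> V) x" for c x
        using True U V
        by (cases "unitary_op U") (auto simp: isometric_op_def unitary_op_scale antiunitary_op_scale)
      show "cinner ((U \<circ> V) x) ((U \<circ> V) y) = cinner x y" for x y
        using True U V
        by (cases "unitary_op U") (auto simp: isometric_op_def unitary_op_def antiunitary_op_def)
    qed
    thus ?thesis by (simp add: isometric_op_def)
  next
    case False
    have "antiunitary_op (U \<circ> V)"
    proof (rule antiunitary_opI[OF add _ bij])
      show "(U \<circ> V) (c *s x) = cnj c *s (U \<circ> V) x" for c x
        using False U V
        by (cases "unitary_op U") (auto simp: isometric_op_def unitary_op_scale antiunitary_op_scale)
      show "cinner ((U \<circ> V) x) ((U \<circ> V) y) = cnj (cinner x y)" for x y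
        using False U V
        by (cases "unitary_op U") (auto simp: isometric_op_def unitary_op_def antiunitary_op_def)
    qed
    thus ?thesis by (simp add: isometric_op_def)
  qed
qed

lemma dagger_conj_vec: "isometric_op U \<Longrightarrow> dagger_conj U G *v x = inv U (G *v U x)"
  unfolding isometric_op_def by (rule dagger_conj_mult_vec)

lemma dagger_conj_comp:
  assumes "isometric_op U" "isometric_op V"
  shows "dagger_conj (V \<circ> U) G = dagger_conj U (dagger_conj V G)"
  using assms unfolding matrix_eq
  by (simp add: dagger_conj_vec isometric_op_comp isometric_op_bij o_inv_distrib)

lemma dagger_conj_inv [simp]:
  assumes "isometric_op U"
  shows "dagger_conj U (dagger_conj (inv U) G) = G" "dagger_conj (inv U) (dagger_conj U G) = G"
  using assms unfolding matrix_eq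
  by (simp_all add: dagger_conj_vec isometric_op_inv isometric_op_bij inv_inv_eq)

lemma linear_dagger_conj:
  assumes "isometric_op U"
  shows "linear (dagger_conj U)"
proof (rule linearI)
  show "dagger_conj U (A + B) = dagger_conj U A + dagger_conj U B" for A B
    using assms unfolding matrix_eq
    by (simp add: dagger_conj_vec matrix_vector_mult_add_rdistrib isometric_op_add isometric_op_inv)
  show "dagger_conj U (r *\<^sub>R A) = r *\<^sub>R dagger_conj U A" for r A
    using assms unfolding matrix_eq
    by (simp add: dagger_conj_vec scaleR_matrix_mult isometric_op_scaleR isometric_op_inv)
qed

lemma cinner_dagger_conj:
  assumes "isometric_op U"
  shows "Re (cinner x (dagger_conj U G *v y)) = Re (cinner (U x) (G *v U y))"
  using isometric_op_Re_cinner[OF assms, of x "dagger_conj U G *v y"] assms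
  by (simp add: dagger_conj_vec)

lemma Re_cinner_commute: "Re (cinner x y) = Re (cinner y x)"
  by (simp flip: cnj_cinner[of y x])

text \<open>Replacing \<open>x\<close> by \<open>\<i> *s x\<close> recovers the imaginary part. The
  real criterion suits anti-unitary operators, which conjugate the inner product but keep its real
  part.\<close>

lemma hermitians_iff_Re:
  "G \<in> hermitians \<longleftrightarrow> (\<forall>x y. Re (cinner (G *v x) y) = Re (cinner x (G *v y)))"
proof
  assume *: "\<forall>x y. Re (cinner (G *v x) y) = Re (cinner x (G *v y))"
  have "cinner (G *v x) y = cinner x (G *v y)" for x y
  proof (rule complex_eqI)
    show "Re (cinner (G *v x) y) = Re (cinner x (G *v y))"
      using * by blast
    have "Re (cinner (G *v (\<i> *s x)) y) = Re (cinner (\<i> *s x) (G *v y))"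
      using * by blast
    thus "Im (cinner (G *v x) y) = Im (cinner x (G *v y))"
      by (simp add: vector_scalar_commute cinner_scale_left)
  qed
  thus "G \<in> hermitians" by (simp add: hermitians_iff)
qed (simp add: hermitian_cinner)

lemma dagger_conj_hermitian_iff:
  assumes "isometric_op U"
  shows "dagger_conj U G \<in> hermitians \<longleftrightarrow> G \<in> hermitians"
proof -
  have "dagger_conj U G \<in> hermitians \<longleftrightarrow>
      (\<forall>x y. Re (cinner (G *v U x) (U y)) = Re (cinner (U x) (G *v U y)))"
    unfolding hermitians_iff_Re
    by (subst (1) Re_cinner_commute)
      (simp add: cinner_dagger_conj[OF assms] Re_cinner_commute[of "G *v _"])
  also have "\<dots> \<longleftrightarrow> G \<in> hermitians"
    unfolding hermitians_iff_Re using assms by (metis isometric_op_inv_right)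
  finally show ?thesis .
qed

lemma dagger_conj_pos_semidef_iff:
  assumes "isometric_op U"
  shows "pos_semidef (dagger_conj U G) \<longleftrightarrow> pos_semidef G"
  unfolding pos_semidef_def cinner_dagger_conj[OF assms] dagger_conj_hermitian_iff[OF assms]
  using assms by (metis isometric_op_inv_right)

lemma isometric_op_eq_0_iff:
  assumes "isometric_op U"
  shows "U x = 0 \<longleftrightarrow> x = 0"
  using isometric_op_scaleR[OF assms, of 0] isometric_op_inv_left[OF assms]
  by (metis scaleR_zero_left)

lemma dagger_conj_pos_def:
  assumes "isometric_op U" "pos_def G"
  shows "pos_def (dagger_conj U G)"
  using assms unfolding pos_def_def
  by (simp add: cinner_dagger_conj dagger_conj_hermitian_iff isometric_op_eq_0_iff)

lemma dagger_conj_eq_0_iff: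
  assumes "isometric_op U"
  shows "dagger_conj U G = 0 \<longleftrightarrow> G = 0"
  using dagger_conj_inv[OF assms] linear_dagger_conj[OF assms]
    linear_dagger_conj[OF isometric_op_inv[OF assms]]
  by (metis linear_0)

lemma dagger_conj_Hplus_iff: "isometric_op U \<Longrightarrow> dagger_conj U G \<in> Hplus \<longleftrightarrow> G \<in> Hplus"
  by (simp add: Hplus_def dagger_conj_pos_semidef_iff dagger_conj_eq_0_iff)

lemma dagger_conj_mat1: "isometric_op U \<Longrightarrow> dagger_conj U (mat 1) = mat 1"
  unfolding matrix_eq by (simp add: dagger_conj_vec)

lemma dagger_conj_outer:
  assumes U: "isometric_op U"
  shows "dagger_conj U (outer w) = outer (inv U w)"
  unfolding matrix_eq
proof
  fix x
  have "inv U (cinner w (U x) *s w) = cinner (inv U w) x *s inv U w"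
    using U unfolding isometric_op_def
  proof
    assume "unitary_op U"
    thus ?thesis
      by (simp add: unitary_op_adjoint unitary_op_scale unitary_op_inv)
  next
    assume "antiunitary_op U"
    thus ?thesis
      by (simp add: antiunitary_op_adjoint antiunitary_op_scale antiunitary_op_inv)
  qed
  thus "dagger_conj U (outer w) *v x = outer (inv U w) *v x"
    by (simp add: dagger_conj_vec[OF U] outer_mult_vec)
qed

text \<open>Conjugation is a linear bijection that preserves and reflects \<open>hermitians\<close>
  and \<open>Hplus\<close>, so each condition pulls back; in the last one, \<open>\<Delta>\<close>
  is transported by \<open>inv U\<close>.\<close>

lemma SDG_dagger_conj:
  fixes U :: "complex^'n \<Rightarrow> complex^'n"
  assumes U: "isometric_op U" and K: "SDG K"
  shows "SDG {G \<in> hermitians. dagger_conj U G \<in> K}" (is "SDG ?K'")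
  unfolding SDG_def
proof (intro conjI ballI allI impI)
  note lin = linear_dagger_conj[OF U]
  show "?K' \<subseteq> hermitians" by auto
  show "G1 + G2 \<in> ?K'" if "G1 \<in> ?K'" "G2 \<in> ?K'" for G1 G2
    using that K subspace_add[OF subspace_hermitians] by (auto simp: SDG_def linear_add[OF lin])
  show "\<nu> *\<^sub>R G \<in> ?K'" if "G \<in> ?K'" "\<nu> > 0" for G \<nu>
    using that K subspace_scale[OF subspace_hermitians] by (auto simp: SDG_def linear_scale[OF lin])
  show "0 \<notin> ?K'"
    using K by (simp add: SDG_def linear_0[OF lin])
  show "Hplus \<subseteq> ?K'"
  proof
    fix G :: "complex^'n^'n"
    assume G: "G \<in> Hplus"
    hence "dagger_conj U G \<in> K"
      using K dagger_conj_Hplus_iff[OF U] unfolding SDG_def by blast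
    thus "G \<in> ?K'"
      using G by (simp add: Hplus_def pos_semidef_def)
  qed
  fix G assume G: "G \<in> ?K'"
  show "G \<in> Hplus \<or> (\<exists>\<Delta>. pos_def \<Delta> \<and> G - \<Delta> \<in> ?K')"
  proof (cases "G \<in> Hplus")
    case False
    hence "dagger_conj U G \<notin> Hplus" using dagger_conj_Hplus_iff[OF U] by blast
    with G K obtain \<Delta> where \<Delta>: "pos_def \<Delta>" "dagger_conj U G - \<Delta> \<in> K"
      unfolding SDG_def by blast
    define \<Delta>' where "\<Delta>' = dagger_conj (inv U) \<Delta>"
    have "pos_def \<Delta>'"
      unfolding \<Delta>'_def by (rule dagger_conj_pos_def[OF isometric_op_inv[OF U] \<Delta>(1)])
    moreover have "dagger_conj U (G - \<Delta>') \<in> K"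
      using \<Delta>(2) U by (simp add: linear_diff[OF lin] \<Delta>'_def)
    moreover have "G - \<Delta>' \<in> hermitians"
      using G \<open>pos_def \<Delta>'\<close> subspace_diff[OF subspace_hermitians] by (auto simp: pos_def_def)
    ultimately show ?thesis by blast
  qed simp
qed

section \<open>Automorphisms of the positive semidefinite cone\<close>

text \<open>The map is defined and linear on all complex matrices, so that linearity refers to a
  whole type; a temporal coherent transformation is extended to such a map later.\<close>

locale psd_automorphism =
  fixes h :: "complex^'n^'n \<Rightarrow> complex^'n^'n"
  assumes linear: "linear h"
    and surj: "surj h"
    and pos_semidef_iff: "pos_semidef (h G) \<longleftrightarrow> pos_semidef G"
    and unital: "h (mat 1) = mat 1"
begin

lemmas h_add = linear_add[OF linear]
  and h_diff = linear_diff[OF linear]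
  and h_minus = linear_neg[OF linear]
  and h_scaleR = linear_scale[OF linear]
  and h_sum = linear_sum[OF linear]

text \<open>\<open>h\<close> preserves and reflects the order of the cone, so a matrix between 0 and
  \<open>h (outer x)\<close> comes from one between 0 and \<open>outer x\<close>, which lies on the
  ray of \<open>outer x\<close>.\<close>

lemma image_outer:
  obtains y where "h (outer x) = outer y"
proof (rule pos_semidef_extreme_imp_outer)
  show "pos_semidef (h (outer x))"
    by (simp add: pos_semidef_iff pos_semidef_outer)
  fix Q assume Q: "pos_semidef Q" "pos_semidef (h (outer x) - Q)"
  obtain Q' where Q': "Q = h Q'" using surj by blast
  have "pos_semidef Q'" "pos_semidef (outer x - Q')"
    using Q unfolding Q' by (simp_all add: pos_semidef_iff flip: h_diff)
  then obtain c :: real where "Q' = c *\<^sub>R outer x"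
    by (rule pos_semidef_le_outer)
  thus "\<exists>c. Q = c *\<^sub>R h (outer x)"
    by (auto simp: Q' h_scaleR)
qed (use that in blast)

end

section \<open>Automorphisms fixing the diagonal rank-one matrices\<close>

lemma pos_semidef_diag: "pos_semidef A \<Longrightarrow> 0 \<le> Re (A $ i $ i)"
  unfolding pos_semidef_def by (metis cinner_unit_vec_matrix)

lemma outer_unit_vec_nth: "outer (unit_vec i) $ k $ l = (if k = i \<and> l = i then 1 else 0)"
  by (simp add: axis_def)

lemma sum_outer_unit_vec: "(\<Sum>i\<in>UNIV. outer (unit_vec i)) = mat 1"
proof -
  have "(\<Sum>i\<in>UNIV. outer (unit_vec i) $ k $ l) = mat 1 $ k $ l" for k l :: 'a
  proof -
    have "(\<Sum>i\<in>UNIV. outer (unit_vec i) $ k $ l) =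
        (\<Sum>i\<in>UNIV. if i = k then if l = k then 1 else 0 else 0)"
      unfolding outer_unit_vec_nth by (intro sum.cong) auto
    thus ?thesis by (simp add: mat_def)
  qed
  thus ?thesis by (simp add: vec_eq_iff del: outer_nth)
qed

text \<open>The projection \<open>P\<close> onto the complement of \<open>unit_vec i\<close> fixes
  \<open>v\<close>, and Cauchy-Schwarz for \<open>P\<close> is the claimed bound. Its upper side is
  built from matrices that a diagonal automorphism fixes.\<close>

lemma outer_le_complement:
  assumes v: "v $ i = 0"
  shows "pos_semidef (Re (cinner v v) *\<^sub>R (mat 1 - outer (unit_vec i)) - outer v)"
proof -
  define P where "P = mat 1 - outer (unit_vec i :: complex^'a)"
  have Pv: "P *v x = x - (x $ i) *s unit_vec i" for x
    by (simp add: P_def matrix_vector_mult_diff_rdistrib outer_mult_vec)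
  have herm: "P \<in> hermitians"
    unfolding P_def
    by (intro subspace_diff[OF subspace_hermitians] hermitians_mat1 outer_hermitian)
  have psd: "pos_semidef P"
    unfolding pos_semidef_def
  proof (intro conjI herm allI)
    fix x
    have "(cmod (x $ i))\<^sup>2 \<le> (\<Sum>j\<in>UNIV. (cmod (x $ j))\<^sup>2)"
      by (rule member_le_sum) auto
    thus "0 \<le> Re (cinner x (P *v x))"
      unfolding Pv cinner_diff_right cinner_self cinner_scale_right cinner_unit_vec_right
      by (simp flip: cmod_square)
  qed
  show ?thesis
    unfolding pos_semidef_def P_def[symmetric]
  proof (intro conjI allI)
    show "Re (cinner v v) *\<^sub>R P - outer v \<in> hermitians"
      using herm by (intro subspace_diff subspace_scale subspace_hermitians outer_hermitian)
    fix w
    have "P *v v = v" by (simp add: Pv v)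
    with pos_semidef_Cauchy_Schwarz[OF psd, of v w] psd
    have "(cmod (cinner v w))\<^sup>2 \<le> Re (cinner v v) * Re (cinner w (P *v w))"
      by (metis hermitian_cinner herm)
    thus "0 \<le> Re (cinner w ((Re (cinner v v) *\<^sub>R P - outer v) *v w))"
      by (simp add: matrix_vector_mult_diff_rdistrib cinner_diff_right scaleR_matrix_mult
          cinner_scaleR_right cinner_outer del: of_real_power)
  qed
qed

lemma nonneg_if_add_small_nonneg:
  fixes a c :: real
  assumes "\<And>s. s > 0 \<Longrightarrow> 0 \<le> s\<^sup>2 * c + a" "c \<ge> 0"
  shows "0 \<le> a"
proof (rule ccontr)
  assume "\<not> 0 \<le> a"
  hence "a < 0" by simp
  \<comment> \<open>With this number as \<open>s\<^sup>2\<close>, the bound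
    \<open>s\<^sup>2 * c + a\<close> becomes \<open>a / (c + 1)\<close>; the summand 1 covers
    \<open>c = 0\<close>.\<close>
  hence pos: "- a / (c + 1) > 0" using assms(2) by (simp add: divide_neg_pos)
  have "0 \<le> (sqrt (- a / (c + 1)))\<^sup>2 * c + a"
    by (rule assms(1)) (use pos in simp)
  also have "\<dots> = a / (c + 1)"
    using pos assms(2) by (simp add: field_simps)
  also have "\<dots> < 0"
    using \<open>a < 0\<close> assms(2) by (simp add: divide_neg_pos)
  finally show False by simp
qed

text \<open>Built so that sums over \<open>i\<close> and \<open>j\<close> collapse by \<open>sum.delta\<close>;
  for \<open>i = j\<close> the only nonzero entry is \<open>2 Re z\<close>.\<close>

definition herm_unit :: "'n \<Rightarrow> 'n \<Rightarrow> complex \<Rightarrow> complex^'n^'n" where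
  "herm_unit i j z = (\<chi> k l. (if l = j then if k = i then z else 0 else 0) +
     (if k = j then if l = i then cnj z else 0 else 0))"

lemma herm_unit_nth: "herm_unit i j z $ k $ l =
    (if l = j then if k = i then z else 0 else 0) + (if k = j then if l = i then cnj z else 0 else 0)"
  by (simp add: herm_unit_def)

lemma herm_unit_add: "herm_unit i j (z + w) = herm_unit i j z + herm_unit i j w"
  by (simp add: vec_eq_iff herm_unit_nth)

lemma herm_unit_scaleR: "herm_unit i j (r *\<^sub>R z) = r *\<^sub>R herm_unit i j z"
  by (simp add: vec_eq_iff herm_unit_nth scaleR_add_right)

lemma herm_unit_swap: "herm_unit j i (cnj z) = herm_unit i j z"
  by (auto simp: vec_eq_iff herm_unit_nth)

lemma herm_unit_diag: "herm_unit i i z = (2 * Re z) *\<^sub>R outer (unit_vec i)"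
  by (auto simp: vec_eq_iff herm_unit_nth outer_unit_vec_nth complex_eq_iff simp del: outer_nth)

text \<open>This reduces the action of \<open>h\<close> on off-diagonal entries to its action on
  rank-one matrices.\<close>

lemma herm_unit_eq_outer:
  assumes "i \<noteq> j" "\<And>k. k \<noteq> i \<Longrightarrow> k \<noteq> j \<Longrightarrow> x $ k = 0"
  shows "herm_unit i j (x $ i * cnj (x $ j)) =
    outer x - (cmod (x $ i))\<^sup>2 *\<^sub>R outer (unit_vec i) - (cmod (x $ j))\<^sup>2 *\<^sub>R outer (unit_vec j)"
  (is "?L = ?R")
proof -
  have "?L $ k $ l = ?R $ k $ l" for k l
    using assms(1) assms(2)[of k] assms(2)[of l]
    by (cases "k = i"; cases "l = i"; cases "k = j"; cases "l = j")
      (simp_all add: herm_unit_nth axis_def scaleR_conv_of_real[where 'a=complex] cmod_square)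
  thus ?thesis by (simp add: vec_eq_iff)
qed

text \<open>The entry at \<open>k\<close>, \<open>l\<close> receives a contribution from the pair
  \<open>(k, l)\<close> and one from \<open>(l, k)\<close>; hence the factor 1/2 in the expansion of
  a Hermitian matrix.\<close>

lemma sum_herm_unit_nth:
  "(\<Sum>i\<in>UNIV. \<Sum>j\<in>UNIV. herm_unit i j (c i j)) $ k $ l = c k l + cnj (c l k)"
  by (simp add: herm_unit_nth sum.distrib)

lemma hermitian_eq_sum_herm_unit:
  assumes "G \<in> hermitians"
  shows "G = (1 / 2) *\<^sub>R (\<Sum>i\<in>UNIV. \<Sum>j\<in>UNIV. herm_unit i j (G $ i $ j))"
proof -
  have "cnj (G $ l $ k) = G $ k $ l" for k l
    using assms unfolding hermitians_def by (metis (mono_tags, lifting) mem_Collect_eq)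
  thus ?thesis
    by (simp only: vec_eq_iff vector_scaleR_component sum_herm_unit_nth)
      (simp add: scaleR_conv_of_real[where 'a=complex])
qed

locale diagonal_psd_automorphism = psd_automorphism +
  assumes diagonal: "h (outer (unit_vec i)) = outer (unit_vec i)"
begin

text \<open>\<open>h\<close> fixes the upper side of \<open>outer_le_complement\<close>, whose
  diagonal entry at \<open>i\<close> is 0, so the image of \<open>outer v\<close> below it has entry
  0 there too.\<close>

lemma image_outer_orthogonal:
  assumes "v $ i = 0"
  shows "h (outer v) $ i $ i = 0"
proof -
  obtain y where y: "h (outer v) = outer y" by (rule image_outer)
  have "pos_semidef (h (Re (cinner v v) *\<^sub>R (mat 1 - outer (unit_vec i)) - outer v))"
    using outer_le_complement[OF assms] by (simp add: pos_semidef_iff)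
  moreover have "mat 1 $ i $ i = (1 :: complex)"
    by (simp add: mat_def)
  ultimately have "(cmod (y $ i))\<^sup>2 \<le> 0"
    using pos_semidef_diag[of _ i]
    by (fastforce simp: h_diff h_scaleR unital diagonal y simp flip: cmod_square)
  thus ?thesis by (simp add: y)
qed

text \<open>The cross term \<open>N\<close> has diagonal entry \<open>0\<close>: the images of \<open>outer (s u \<plusminus> v / s)\<close> are
  positive semidefinite, so that \<open>\<plusminus> N\<close> is bounded below by a multiple of \<open>s\<^sup>2\<close> for every \<open>s > 0\<close>.\<close>

lemma image_outer_diag: "Re (h (outer x) $ i $ i) = (cmod (x $ i))\<^sup>2"
proof -
  define u where "u = (x $ i) *s unit_vec i"
  define N where "N = (\<lambda>v. outer (u + v) - outer u - outer v)"
  have u: "Re (h (outer u) $ i $ i) = (cmod (x $ i))\<^sup>2"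
    by (simp add: u_def outer_scale h_scaleR diagonal)
  have N: "0 \<le> Re (h (N v) $ i $ i)" if v: "v $ i = 0" for v
  proof (rule nonneg_if_add_small_nonneg)
    fix s :: real assume "s > 0"
    \<comment> \<open>The weights \<open>s\<close> and \<open>1 / s\<close> cancel in the cross
      term, and the \<open>outer v\<close> term contributes nothing at \<open>i\<close>.\<close>
    have "outer (s *\<^sub>R u + (1 / s) *\<^sub>R v) = s\<^sup>2 *\<^sub>R outer u + (1 / s\<^sup>2) *\<^sub>R outer v + N v"
      using \<open>s > 0\<close>
      by (simp add: vec_eq_iff N_def scaleR_conv_of_real[where 'a=complex] field_simps power2_eq_square)
    hence "pos_semidef (h (s\<^sup>2 *\<^sub>R outer u + (1 / s\<^sup>2) *\<^sub>R outer v + N v))"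
      by (metis pos_semidef_iff pos_semidef_outer)
    from pos_semidef_diag[OF this, of i]
    show "0 \<le> s\<^sup>2 * (cmod (x $ i))\<^sup>2 + Re (h (N v) $ i $ i)"
      by (simp add: h_add h_scaleR image_outer_orthogonal[OF v] u)
  qed simp
  define v where "v = x - u"
  have v: "v $ i = 0" by (simp add: v_def u_def)
  have "N (- v) = - N v"
    by (simp add: N_def vec_eq_iff algebra_simps)
  with N[of v] N[of "- v"] v have "Re (h (N v) $ i $ i) = 0"
    by (simp add: h_minus)
  moreover have "outer x = outer u + outer v + N v"
    by (simp add: N_def v_def)
  ultimately show ?thesis
    by (simp add: h_add image_outer_orthogonal[OF v] u)
qed

lemma image_outer_modulus:
  obtains y where "h (outer x) = outer y" "\<And>i. cmod (y $ i) = cmod (x $ i)"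
proof -
  obtain y where y: "h (outer x) = outer y" by (rule image_outer)
  have "(cmod (y $ i))\<^sup>2 = (cmod (x $ i))\<^sup>2" for i
    using image_outer_diag[of x i] by (simp add: y flip: cmod_square)
  thus ?thesis using that y by simp
qed

text \<open>This is the action of \<open>h\<close> on a single entry. On the diagonal
  \<open>herm_unit i i z\<close> sees only \<open>Re z\<close>, so the identity is imposed there,
  which keeps later formulas uniform in \<open>i\<close> and \<open>j\<close>.\<close>

definition phi :: "'a \<Rightarrow> 'a \<Rightarrow> complex \<Rightarrow> complex" where
  "phi i j z = (if i = j then z else h (herm_unit i j z) $ i $ j)"

lemma image_herm_unit: "h (herm_unit i j z) = herm_unit i j (phi i j z)"
  and cmod_phi: "cmod (phi i j z) = cmod z"
proof -
  have "h (herm_unit i j z) = herm_unit i j (phi i j z) \<and> cmod (phi i j z) = cmod z"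
  proof (cases "i = j")
    case True
    thus ?thesis
      by (simp add: phi_def herm_unit_diag h_scaleR diagonal)
  next
    case False
    \<comment> \<open>Here \<open>x $ i * cnj (x $ j) = z\<close>. As moduli are kept, the image
      vector \<open>y\<close> is again supported on \<open>i\<close> and \<open>j\<close>, and
      \<open>herm_unit_eq_outer\<close> applies to both.\<close>
    define x where "x = z *s unit_vec i + unit_vec j"
    have x: "x $ i = z" "x $ j = 1" "\<And>k. k \<noteq> i \<Longrightarrow> k \<noteq> j \<Longrightarrow> x $ k = 0"
      using False by (simp_all add: x_def axis_def)
    obtain y where y: "h (outer x) = outer y" "\<And>i. cmod (y $ i) = cmod (x $ i)"
      using image_outer_modulus by blast
    have y0: "y $ k = 0" if "k \<noteq> i" "k \<noteq> j" for k
      using y(2)[of k] x(3)[OF that] by simp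
    have "h (herm_unit i j z) = herm_unit i j (y $ i * cnj (y $ j))"
      using herm_unit_eq_outer[OF False x(3)] herm_unit_eq_outer[OF False y0] y(2)
      by (simp add: x(1,2) y(1) h_diff h_scaleR diagonal)
    moreover from this have "phi i j z = y $ i * cnj (y $ j)"
      using False by (simp add: phi_def herm_unit_nth)
    ultimately show ?thesis
      using y(2)[of i] y(2)[of j] x(1,2) by (simp add: norm_mult)
  qed
  thus "h (herm_unit i j z) = herm_unit i j (phi i j z)" "cmod (phi i j z) = cmod z"
    by blast+
qed

lemma phi_add: "phi i j (z + w) = phi i j z + phi i j w"
  by (simp add: phi_def herm_unit_add h_add)

lemma phi_scaleR: "phi i j (r *\<^sub>R z) = r *\<^sub>R phi i j z"
  by (simp add: phi_def herm_unit_scaleR h_scaleR)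

lemma phi_swap: "phi j i (cnj z) = cnj (phi i j z)"
proof (cases "i = j")
  case False
  have "phi j i (cnj z) = h (herm_unit i j z) $ j $ i"
    using False by (simp add: phi_def herm_unit_swap)
  also have "\<dots> = cnj (phi i j z)"
    using False by (simp add: image_herm_unit herm_unit_nth)
  finally show ?thesis .
qed (simp add: phi_def)

lemma image_nth:
  assumes "G \<in> hermitians"
  shows "h G $ k $ l = phi k l (G $ k $ l)"
proof -
  have cnj: "cnj (G $ l $ k) = G $ k $ l" for k l
    using assms unfolding hermitians_def by (metis (mono_tags, lifting) mem_Collect_eq)
  have "h G = (1 / 2) *\<^sub>R (\<Sum>i\<in>UNIV. \<Sum>j\<in>UNIV. herm_unit i j (phi i j (G $ i $ j)))"
    by (subst hermitian_eq_sum_herm_unit[OF assms])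
      (simp only: h_scaleR h_sum image_herm_unit)
  also have "\<dots> $ k $ l = (1 / 2) *\<^sub>R (phi k l (G $ k $ l) + cnj (phi l k (G $ l $ k)))"
    by (simp only: vector_scaleR_component sum_herm_unit_nth)
  also have "\<dots> = phi k l (G $ k $ l)"
    by (simp add: cnj scaleR_conv_of_real[where 'a=complex] flip: phi_swap)
  finally show ?thesis .
qed

text \<open>A positive semidefinite matrix of rank one with unimodular entries satisfies
  \<open>a\<^sub>i\<^sub>j a\<^sub>j\<^sub>k = a\<^sub>i\<^sub>k\<close>.\<close>

lemma phi_cocycle:
  assumes "\<And>i. cmod (c i) = 1"
  shows "phi i j (c i * cnj (c j)) * phi j k (c j * cnj (c k)) = phi i k (c i * cnj (c k))"
proof -
  define x where "x = (\<chi> i. c i)"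
  obtain y where y: "h (outer x) = outer y" "\<And>i. cmod (y $ i) = cmod (x $ i)"
    using image_outer_modulus by blast
  have phi: "phi i j (c i * cnj (c j)) = y $ i * cnj (y $ j)" for i j
    using image_nth[OF outer_hermitian, of x i j] unfolding y(1) by (simp add: x_def)
  have "cnj (y $ j) * y $ j = 1"
    using y(2)[of j] assms[of j] cmod_square[of "y $ j"] by (simp add: x_def mult.commute)
  hence "y $ i * (cnj (y $ j) * y $ j) * cnj (y $ k) = y $ i * cnj (y $ k)" by simp
  thus ?thesis by (simp add: phi mult.assoc)
qed

text \<open>The value \<open>\<i>\<close> means that \<open>phi i j\<close> is multiplication by
  \<open>phi i j 1\<close>; the value \<open>- \<i>\<close> means that conjugation is applied
  first.\<close>

definition sgn_i :: "'a \<Rightarrow> 'a \<Rightarrow> complex" where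
  "sgn_i i j = phi i j \<i> / phi i j 1"

lemma phi_one_nonzero [simp]: "phi i j 1 \<noteq> 0"
  using cmod_phi[of i j 1] by auto

lemma phi_eq: "phi i j z = phi i j 1 * (of_real (Re z) + of_real (Im z) * sgn_i i j)"
proof -
  have "z = Re z *\<^sub>R 1 + Im z *\<^sub>R \<i>"
    by (simp add: complex_eq_iff)
  hence "phi i j z = phi i j (Re z *\<^sub>R 1 + Im z *\<^sub>R \<i>)"
    by (rule arg_cong)
  also have "\<dots> = phi i j 1 * (of_real (Re z) + of_real (Im z) * sgn_i i j)"
    by (simp only: phi_add phi_scaleR)
      (simp add: scaleR_conv_of_real[where 'a=complex] sgn_i_def algebra_simps)
  finally show ?thesis .
qed

text \<open>As \<open>phi i j\<close> preserves the moduli of \<open>1\<close>, \<open>\<i>\<close>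
  and \<open>1 + \<i>\<close>, both \<open>s\<close> and \<open>1 + s\<close> have the moduli of
  \<open>\<i>\<close> and \<open>1 + \<i>\<close>, so \<open>s\<close> is purely imaginary.\<close>

lemma sgn_i_cases: "sgn_i i j = \<i> \<or> sgn_i i j = - \<i>"
proof -
  define s where "s = sgn_i i j"
  have u: "cmod (phi i j 1) = 1" by (simp add: cmod_phi)
  have "cmod s = 1"
    using u by (simp add: s_def sgn_i_def norm_divide cmod_phi)
  moreover have "cmod (1 + s) = cmod (1 + \<i>)"
    using cmod_phi[of i j "1 + \<i>"] phi_eq[of i j "1 + \<i>"] u by (simp add: s_def norm_mult)
  ultimately have "(Re s)\<^sup>2 + (Im s)\<^sup>2 = 1" "(1 + Re s)\<^sup>2 + (Im s)\<^sup>2 = 2"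
    by (simp_all add: cmod_def)
  moreover from this have "Re s = 0"
    by (simp add: power2_eq_square algebra_simps)
  ultimately have "Re s = 0" "(Im s)\<^sup>2 = 1"
    by simp_all
  thus ?thesis
    by (auto simp: s_def[symmetric] complex_eq_iff power2_eq_1_iff)
qed

text \<open>Hermitian symmetry yields \<open>- cnj (sgn_i i j)\<close>, and this operation fixes
  both possible values.\<close>

lemma sgn_i_swap: "sgn_i j i = sgn_i i j"
proof -
  have "phi j i (- \<i>) = cnj (phi i j \<i>)" "phi j i 1 = cnj (phi i j 1)"
    using phi_swap[of j i \<i>] phi_swap[of j i 1] by simp_all
  moreover have "phi j i (- \<i>) = - phi j i \<i>"
    using phi_scaleR[of j i "- 1" \<i>] by simp
  ultimately have "sgn_i j i = - cnj (sgn_i i j)"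
    by (simp add: sgn_i_def) (metis minus_equation_iff minus_divide_left)
  thus ?thesis using sgn_i_cases[of i j] by auto
qed

lemma sgn_i_row:
  assumes "i \<noteq> j" "i \<noteq> k"
  shows "sgn_i i j = sgn_i i k"
proof -
  \<comment> \<open>Comparing the cocycle identity for this vector with that for the constant vector
    1, the common factor \<open>phi j k 1\<close> cancels.\<close>
  define c where "c = (\<lambda>l. if l = i then \<i> else 1)"
  have "phi i j \<i> * phi j k 1 = phi i k \<i>"
    using phi_cocycle[of c i j k] assms by (simp add: c_def)
  moreover have "phi i j 1 * phi j k 1 = phi i k 1"
    using phi_cocycle[of "\<lambda>_. 1" i j k] by simp
  ultimately show ?thesis
    unfolding sgn_i_def by (metis mult_divide_mult_cancel_right phi_one_nonzero)
qed

text \<open>Swapping indices and changing one at a time connects any two pairs of distinct indices.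
  In dimension one there are no such pairs.\<close>

lemma sgn_i_const: "\<exists>\<sigma>. (\<sigma> = \<i> \<or> \<sigma> = - \<i>) \<and> (\<forall>i j. i \<noteq> j \<longrightarrow> sgn_i i j = \<sigma>)"
proof (cases "\<exists>a b :: 'a. a \<noteq> b")
  case True
  then obtain a b :: 'a where ab: "a \<noteq> b" by blast
  have "sgn_i i j = sgn_i a b" if "i \<noteq> j" for i j
    using that ab by (metis sgn_i_row sgn_i_swap)
  thus ?thesis using sgn_i_cases by blast
qed blast

lemma image_form:
  obtains d \<psi> where "\<And>i. cmod (d i) = 1" "\<psi> = id \<or> \<psi> = cnj"
    "\<And>G k l. G \<in> hermitians \<Longrightarrow> h G $ k $ l = d k * \<psi> (G $ k $ l) * cnj (d l)"
proof -
  obtain \<sigma> where \<sigma>: "\<sigma> = \<i> \<or> \<sigma> = - \<i>" "\<And>i j. i \<noteq> j \<Longrightarrow> sgn_i i j = \<sigma>"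
    using sgn_i_const by metis
  define \<psi> where "\<psi> = (\<lambda>z. of_real (Re z) + of_real (Im z) * \<sigma>)"
  obtain a :: 'a where True by simp
  define d where "d = (\<lambda>i. phi i a 1)"
  have d: "cmod (d i) = 1" for i by (simp add: d_def cmod_phi)
  \<comment> \<open>The cocycle identity through the fixed index \<open>a\<close>, with
    \<open>phi_swap\<close> for the second factor.\<close>
  have dd: "phi k l 1 = d k * cnj (d l)" for k l
    using phi_cocycle[of "\<lambda>_. 1" k a l] phi_swap[of l a 1] by (simp add: d_def)
  have "phi k l (G $ k $ l) = d k * \<psi> (G $ k $ l) * cnj (d l)" if "G \<in> hermitians" for G k l
  proof (cases "k = l")
    case True
    \<comment> \<open>\<open>phi k k\<close> is the identity for either \<open>\<psi>\<close>; the
      entry is real, so \<open>\<psi>\<close> fixes it.\<close>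
    have "cnj (G $ k $ k) = G $ k $ k"
      using that unfolding hermitians_def by (metis (mono_tags, lifting) mem_Collect_eq)
    hence "\<psi> (G $ k $ k) = G $ k $ k"
      by (simp add: \<psi>_def complex_eq_iff)
    moreover have "d k * cnj (d k) = 1"
      using cmod_square[of "d k"] d[of k] by simp
    hence "d k * z * cnj (d k) = z" for z
      by (simp add: mult.commute[of "d k" z] mult.assoc)
    ultimately show ?thesis
      using True by (simp add: phi_def)
  next
    case False
    show ?thesis
      unfolding phi_eq[of k l "G $ k $ l"] dd \<sigma>(2)[OF False] \<psi>_def by (simp add: mult_ac)
  qed
  moreover have "\<psi> = id \<or> \<psi> = cnj"
    using \<sigma>(1) by (auto simp: \<psi>_def fun_eq_iff complex_eq_iff)
  ultimately show ?thesis
    using that[of d \<psi>] d by (simp add: image_nth)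
qed

end

section \<open>Reconstruction of the operator\<close>

lemma isometric_op_coordinatewise:
  fixes d :: "'n::finite \<Rightarrow> complex"
  assumes d: "\<And>i. cmod (d i) = 1" and \<psi>: "\<psi> = id \<or> \<psi> = cnj"
  shows "isometric_op (\<lambda>x :: complex^'n. \<chi> i. \<psi> (cnj (d i) * x $ i))" (is "isometric_op ?S")
proof -
  have dd: "cnj (d i) * d i = 1" "d i * cnj (d i) = 1" for i
    using cmod_square[of "d i"] d[of i] by (simp_all add: mult.commute)
  have dd': "cnj (d i) * (d i * z) = z" "d i * (cnj (d i) * z) = z" for i z
    using dd[of i] by (simp_all flip: mult.assoc)
  have "?S \<circ> (\<lambda>x. \<chi> i. d i * \<psi> (x $ i)) = id" "(\<lambda>x. \<chi> i. d i * \<psi> (x $ i)) \<circ> ?S = id"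
    using \<psi> by (auto simp: fun_eq_iff vec_eq_iff dd')
  hence bij: "bij ?S" by (rule o_bij[rotated])
  show ?thesis
    using \<psi>
  proof
    assume id: "\<psi> = id"
    have "unitary_op ?S"
    proof (rule unitary_opI[OF _ _ bij])
      have "cnj (cnj (d i) * a) * (cnj (d i) * b) = cnj a * b" for i a b
        using dd'(2)[of i "cnj a * b"] by (simp add: mult_ac)
      thus "cinner (?S x) (?S y) = cinner x y" for x y
        by (simp only: cinner_def id vec_lambda_beta id_apply)
    qed (simp_all add: id vec_eq_iff algebra_simps)
    thus ?thesis by (simp add: isometric_op_def)
  next
    assume cnj: "\<psi> = cnj"
    have "antiunitary_op ?S"
    proof (rule antiunitary_opI[OF _ _ bij])
      have "cnj (cnj (cnj (d i) * a)) * cnj (cnj (d i) * b) = a * cnj b" for i a b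
        using dd'(1)[of i "a * cnj b"] by (simp add: mult_ac)
      thus "cinner (?S x) (?S y) = cnj (cinner x y)" for x y
        by (simp only: cinner_def cnj vec_lambda_beta cnj_sum complex_cnj_mult complex_cnj_cnj)
    qed (simp_all add: cnj vec_eq_iff algebra_simps)
    thus ?thesis by (simp add: isometric_op_def)
  qed
qed

text \<open>\<open>S\<close> is chosen to satisfy \<open>S (h G *v x) = G *v S x\<close>: the factor
  \<open>cnj (d k)\<close> removes \<open>d k\<close>, and \<open>\<psi>\<close> is additive,
  multiplicative and its own inverse.\<close>

lemma (in diagonal_psd_automorphism) exists_isometric_op:
  "\<exists>S. isometric_op S \<and> (\<forall>G\<in>hermitians. h G = dagger_conj S G)"
proof -
  obtain d \<psi> where d: "\<And>i. cmod (d i) = 1" and \<psi>: "\<psi> = id \<or> \<psi> = cnj"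
    and h: "\<And>G k l. G \<in> hermitians \<Longrightarrow> h G $ k $ l = d k * \<psi> (G $ k $ l) * cnj (d l)"
    by (rule image_form) blast
  define S where "S = (\<lambda>x :: complex^'a. \<chi> i. \<psi> (cnj (d i) * x $ i))"
  have S: "isometric_op S"
    unfolding S_def by (rule isometric_op_coordinatewise[OF d \<psi>])
  have dd: "cnj (d i) * (d i * z) = z" for i z
    using cmod_square[of "d i"] d[of i] by (metis mult.assoc mult.commute mult_1 of_real_1 one_power2)
  have \<psi>_mult: "\<psi> (a * b) = \<psi> a * \<psi> b" and \<psi>_sum: "\<psi> (sum f A) = (\<Sum>i\<in>A. \<psi> (f i))"
    and \<psi>_\<psi>: "\<psi> (\<psi> a) = a" for a b and f :: "'a \<Rightarrow> complex" and A
    using \<psi> by auto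
  have "h G *v x = dagger_conj S G *v x" if G: "G \<in> hermitians" for G x
  proof -
    have "S (h G *v x) $ k = (G *v S x) $ k" for k
    proof -
      have "S (h G *v x) $ k = (\<Sum>l\<in>UNIV. \<psi> (cnj (d k) * (h G $ k $ l * x $ l)))"
        by (simp add: S_def matrix_vector_mult_def sum_distrib_left \<psi>_sum)
      also have "\<dots> = (\<Sum>l\<in>UNIV. G $ k $ l * \<psi> (cnj (d l) * x $ l))"
      proof (rule sum.cong[OF refl])
        fix l
        have eq: "cnj (d k) * (h G $ k $ l * x $ l) = \<psi> (G $ k $ l) * (cnj (d l) * x $ l)"
          using dd[of k "\<psi> (G $ k $ l) * (cnj (d l) * x $ l)"] by (simp add: h[OF G] mult_ac)
        show "\<psi> (cnj (d k) * (h G $ k $ l * x $ l)) = G $ k $ l * \<psi> (cnj (d l) * x $ l)"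
          unfolding eq by (simp only: \<psi>_mult \<psi>_\<psi>)
      qed
      finally show ?thesis by (simp add: S_def matrix_vector_mult_def)
    qed
    hence "S (h G *v x) = G *v S x" by (simp add: vec_eq_iff)
    hence "h G *v x = inv S (G *v S x)"
      using isometric_op_inv_left[OF S] by metis
    thus ?thesis by (simp add: dagger_conj_vec[OF S])
  qed
  thus ?thesis using S matrix_eq by blast
qed

text \<open>With the \<open>f i\<close> as columns of \<open>F\<close>, the hypothesis says that
  \<open>F\<close> times its adjoint \<open>A\<close> is the identity. For square matrices
  \<open>A\<close> is then also a left inverse, so \<open>F\<close> is unitary.\<close>

lemma exists_unitary_op_unit_vec:
  fixes f :: "'n::finite \<Rightarrow> complex^'n"
  assumes "(\<Sum>i\<in>UNIV. outer (f i)) = mat 1"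
  obtains U where "unitary_op U" "\<And>i. U (unit_vec i) = f i"
proof -
  define F where "F = (\<chi> k i. f i $ k)"
  define A where "A = (\<chi> i k. cnj (f i $ k))"
  have "(F ** A) $ k $ l = (\<Sum>i\<in>UNIV. outer (f i)) $ k $ l" for k l
    by (simp add: F_def A_def matrix_matrix_mult_def)
  hence FA: "F ** A = mat 1" using assms by (simp add: vec_eq_iff)
  hence AF: "A ** F = mat 1" by (simp add: matrix_left_right_inverse)
  have adjoint: "cinner (F *v x) y = cinner x (A *v y)" for x y
  proof -
    have "cinner (F *v x) y = (\<Sum>k\<in>UNIV. \<Sum>i\<in>UNIV. cnj (f i $ k) * cnj (x $ i) * y $ k)"
      by (simp add: cinner_def matrix_vector_mult_def sum_distrib_right F_def)
    also have "\<dots> = cinner x (A *v y)"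
      by (subst sum.swap) (simp add: cinner_def matrix_vector_mult_def sum_distrib_left A_def mult_ac)
    finally show ?thesis .
  qed
  have "unitary_op ((*v) F)"
  proof (rule unitary_opI)
    have "(*v) F \<circ> (*v) A = id" "(*v) A \<circ> (*v) F = id"
      by (auto simp: fun_eq_iff matrix_vector_mul_assoc FA AF)
    thus "bij ((*v) F)" by (rule o_bij[rotated])
    show "cinner (F *v x) (F *v y) = cinner x y" for x y
      by (simp add: adjoint matrix_vector_mul_assoc AF)
  qed (simp_all add: matrix_vector_right_distrib vector_scalar_commute)
  moreover have "F *v unit_vec i = f i" for i
    by (simp add: vec_eq_iff matrix_mult_unit_vec_nth) (simp add: F_def)
  ultimately show ?thesis using that by blast
qed

lemma (in psd_automorphism) exists_isometric_op:
  "\<exists>U. isometric_op U \<and> (\<forall>G\<in>hermitians. h G = dagger_conj U G)"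
proof -
  have "\<forall>i. \<exists>y. h (outer (unit_vec i)) = outer y"
    using image_outer by metis
  then obtain f where f: "\<And>i. h (outer (unit_vec i)) = outer (f i)" by metis
  have "(\<Sum>i\<in>UNIV. outer (f i)) = mat 1"
    by (simp add: sum_outer_unit_vec unital flip: f h_sum)
  then obtain F where "unitary_op F" and F_unit: "\<And>i. F (unit_vec i) = f i"
    by (rule exists_unitary_op_unit_vec) blast
  hence F: "isometric_op F" by (simp add: isometric_op_def)
  \<comment> \<open>Conjugation by \<open>F\<close> carries \<open>outer (f i)\<close> back to
    \<open>outer (unit_vec i)\<close>. Undoing it afterwards gives the operator
    \<open>S \<circ> inv F\<close>.\<close>
  have "diagonal_psd_automorphism (dagger_conj F \<circ> h)"
    unfolding diagonal_psd_automorphism_def psd_automorphism_def diagonal_psd_automorphism_axioms_def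
  proof (intro conjI allI)
    show "linear (dagger_conj F \<circ> h)"
      by (rule linear_compose[OF linear linear_dagger_conj[OF F]])
    have "surj (dagger_conj F)"
      using dagger_conj_inv(1)[OF F] by (metis surjI)
    thus "surj (dagger_conj F \<circ> h)" by (rule comp_surj[OF surj])
    show "pos_semidef ((dagger_conj F \<circ> h) G) \<longleftrightarrow> pos_semidef G" for G
      by (simp add: dagger_conj_pos_semidef_iff[OF F] pos_semidef_iff)
    show "(dagger_conj F \<circ> h) (mat 1) = mat 1"
      by (simp add: unital dagger_conj_mat1[OF F])
    show "(dagger_conj F \<circ> h) (outer (unit_vec i)) = outer (unit_vec i)" for i
      using isometric_op_inv_left[OF F, of "unit_vec i"]
      by (simp add: f dagger_conj_outer[OF F] F_unit)
  qed
  then obtain S where S: "isometric_op S"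
    and hS: "\<And>G. G \<in> hermitians \<Longrightarrow> dagger_conj F (h G) = dagger_conj S G"
    using diagonal_psd_automorphism.exists_isometric_op by fastforce
  have "h G = dagger_conj (S \<circ> inv F) G" if "G \<in> hermitians" for G
    using hS[OF that] dagger_conj_inv(2)[OF F, of "h G"]
    by (simp add: dagger_conj_comp isometric_op_inv F S)
  thus ?thesis
    using isometric_op_comp[OF S isometric_op_inv[OF F]] by blast
qed

section \<open>Linear extension of a temporal coherent transformation\<close>

definition adjoint_mat :: "complex^'n^'n \<Rightarrow> complex^'n^'n" where
  "adjoint_mat A = (\<chi> i j. cnj (A $ j $ i))"

lemma hermitian_iff_adjoint_mat: "A \<in> hermitians \<longleftrightarrow> adjoint_mat A = A"
  unfolding hermitians_def adjoint_mat_def vec_eq_iff by (simp add: eq_commute)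

text \<open>Extending \<open>h\<close> by the identity on the skew-Hermitian matrices makes it an endomorphism of a
  Euclidean space, for which surjectivity implies injectivity.\<close>

lemma temporal_coherent_linear:
  assumes "temporal_coherent h"
  obtains H where "psd_automorphism H" "\<And>G. G \<in> hermitians \<Longrightarrow> H G = h G"
proof -
  have onto: "h ` hermitians = hermitians" and unital: "h (real c *\<^sub>R mat 1) = real c *\<^sub>R mat 1"
    and Hplus: "h ` Hplus = Hplus"
    and comb: "G1 \<in> hermitians \<Longrightarrow> G2 \<in> hermitians \<Longrightarrow> 0 < \<alpha> \<Longrightarrow> 0 < \<beta> \<Longrightarrow>
      h (\<alpha> *\<^sub>R G1 + \<beta> *\<^sub>R G2) = \<alpha> *\<^sub>R h G1 + \<beta> *\<^sub>R h G2" for c G1 G2 \<alpha> \<beta>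
    using assms unfolding temporal_coherent_def by blast+
  note sub = subspace_hermitians
  have h0: "h 0 = 0" using unital[of 0] by simp
  have h_add: "h (G1 + G2) = h G1 + h G2" if "G1 \<in> hermitians" "G2 \<in> hermitians" for G1 G2
    using comb[OF that, of 1 1] by simp
  \<comment> \<open>Both coefficients have to be positive, so the second matrix is taken to be
    0.\<close>
  have h_pos: "h (r *\<^sub>R G) = r *\<^sub>R h G" if "G \<in> hermitians" "r > 0" for r G
    using comb[OF that(1) subspace_0[OF sub] that(2), of 1] h0 by simp
  have h_neg: "h (- G) = - h G" if "G \<in> hermitians" for G
    using h_add[OF that subspace_neg[OF sub that]] h0 by (simp add: eq_neg_iff_add_eq_0 add.commute)
  have h_scale: "h (r *\<^sub>R G) = r *\<^sub>R h G" if G: "G \<in> hermitians" for r G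
  proof (cases r "0 :: real" rule: linorder_cases)
    case less
    have "h (r *\<^sub>R G) = h (- ((- r) *\<^sub>R G))" by simp
    also have "\<dots> = r *\<^sub>R h G"
      using h_neg[OF subspace_scale[OF sub G, of "- r"]] h_pos[OF G, of "- r"] less by simp
    finally show ?thesis .
  qed (use h0 h_pos[OF G] in auto)
  \<comment> \<open>\<open>P\<close> is the projection onto the Hermitian part, with the
    skew-Hermitian matrices as kernel.\<close>
  define P where "P = (\<lambda>A. (1 / 2) *\<^sub>R (A + adjoint_mat A :: complex^'a^'a))"
  have P_herm: "P A \<in> hermitians" for A
    by (simp add: hermitian_iff_adjoint_mat P_def adjoint_mat_def vec_eq_iff add.commute)
  have P_id: "P A = A" if "A \<in> hermitians" for A
    using that by (simp add: hermitian_iff_adjoint_mat P_def flip: scaleR_2)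
  have P_linear: "P (A + B) = P A + P B" "P (r *\<^sub>R A) = r *\<^sub>R P A" for A B r
    by (simp_all add: P_def adjoint_mat_def vec_eq_iff algebra_simps)
  define H where "H = (\<lambda>A. h (P A) + (A - P A))"
  have H_eq: "H G = h G" if "G \<in> hermitians" for G
    using that by (simp add: H_def P_id)
  have "linear H"
    by (rule linearI) (simp_all add: H_def P_linear h_add h_scale P_herm algebra_simps)
  have "surj H"
    unfolding surj_def
  proof
    fix B
    obtain G where G: "G \<in> hermitians" "h G = P B"
      using P_herm[of B] onto by (metis imageE)
    \<comment> \<open>The preimage of \<open>B\<close> combines \<open>G\<close> with the
      skew-Hermitian part \<open>B - P B\<close>, which \<open>H\<close> leaves alone.\<close>
    have "P (B - P B) = 0"
      using P_linear(1)[of "B - P B" "P B"] P_id[OF P_herm] by simp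
    hence "H (G + (B - P B)) = B"
      using G by (simp add: H_def P_linear(1) P_id)
    thus "\<exists>A. B = H A" by metis
  qed
  hence "inj H"
    using \<open>linear H\<close> by (simp add: linear_surjective_imp_injective)
  have Hplus': "H ` Hplus = Hplus"
  proof -
    have "H ` Hplus = h ` Hplus"
      by (rule image_cong[OF refl]) (simp add: H_eq Hplus_def pos_semidef_def)
    thus ?thesis using Hplus by simp
  qed
  have psd: "pos_semidef G \<longleftrightarrow> G = 0 \<or> G \<in> Hplus" for G :: "complex^'a^'a"
    by (auto simp: Hplus_def pos_semidef_def subspace_0[OF sub])
  have "psd_automorphism H"
    unfolding psd_automorphism_def
  proof (intro conjI allI)
    show "H (mat 1) = mat 1"
      using unital[of 1] by (simp add: H_eq hermitians_mat1)
    show "pos_semidef (H G) \<longleftrightarrow> pos_semidef G" for G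
      using inj_image_mem_iff[OF \<open>inj H\<close>, of G Hplus] inj_eq[OF \<open>inj H\<close>, of G 0]
      by (simp add: psd Hplus' linear_0[OF \<open>linear H\<close>])
  qed fact+
  thus ?thesis using that H_eq by blast
qed

section \<open>Uniqueness up to a phase\<close>

lemma outer_eq_imp_unimodular_multiple:
  assumes "outer x = outer y"
  obtains c where "cmod c = 1" "x = c *s y"
proof (cases "y = 0")
  case True
  hence "x = 0" using assms by (metis outer_eq_0_iff)
  thus ?thesis using that[of 1] True by simp
next
  case False
  then obtain i where i: "y $ i \<noteq> 0" by (auto simp: vec_eq_iff)
  have eq: "x $ k * cnj (x $ l) = y $ k * cnj (y $ l)" for k l
    using assms by (metis outer_nth)
  have xi: "x $ i \<noteq> 0" using eq[of i i] i by auto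
  \<comment> \<open>The quotient is read off from column \<open>i\<close> of the two equal
    matrices.\<close>
  define c where "c = cnj (y $ i) / cnj (x $ i)"
  have "x = c *s y"
    using eq[of _ i] xi by (simp add: c_def vec_eq_iff field_simps)
  moreover have "cmod (x $ i) = cmod (y $ i)"
    using arg_cong[OF eq[of i i], of cmod] by (simp add: norm_mult flip: power2_eq_square)
  hence "cmod c = 1" using i by (simp add: c_def norm_divide)
  ultimately show ?thesis using that by blast
qed

text \<open>Comparing \<open>T\<close> on two basis vectors and on their sum shows that all basis
  vectors share one eigenvalue \<open>g\<close>. A conjugate-linear \<open>T\<close> is excluded by
  \<open>unit_vec a + \<i> *s unit_vec b\<close>, whose eigenvalue would be both \<open>g\<close>
  and \<open>- g\<close>.\<close>

lemma additive_eigenvectors_scalar: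
  fixes T :: "complex^'n \<Rightarrow> complex^'n"
  assumes add: "\<And>x y. T (x + y) = T x + T y" and eigen: "\<And>x. \<exists>c. cmod c = 1 \<and> T x = c *s x"
    and scale: "(\<forall>c x. T (c *s x) = c *s T x) \<or>
      CARD('n) \<noteq> 1 \<and> (\<forall>c x. T (c *s x) = cnj c *s T x)"
  shows "\<exists>c. cmod c = 1 \<and> (\<forall>x. T x = c *s x)"
proof -
  obtain a :: 'n where True by simp
  obtain g where g: "cmod g = 1" "T (unit_vec a) = g *s unit_vec a"
    using eigen by blast
  have unit: "T (unit_vec i) = g *s unit_vec i" for i
  proof (cases "i = a")
    case False
    obtain c where c: "T (unit_vec i) = c *s unit_vec i" using eigen by blast
    obtain e where e: "T (unit_vec a + unit_vec i) = e *s (unit_vec a + unit_vec i)"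
      using eigen by blast
    have eq: "(g *s unit_vec a + c *s unit_vec i) $ k = (e *s (unit_vec a + unit_vec i)) $ k" for k
      using e add[of "unit_vec a" "unit_vec i"] g(2) c by simp
    have "g = e" "c = e"
      using eq[of a] eq[of i] False by (auto simp: axis_def)
    thus ?thesis using c by simp
  qed (use g in simp)
  have "T (c *s x) = c *s T x" for c x
  proof (rule ccontr)
    assume "T (c *s x) \<noteq> c *s T x"
    with scale have card: "CARD('n) \<noteq> 1" and conj: "\<And>c x. T (c *s x) = cnj c *s T x" by blast+
    obtain b where "b \<noteq> a"
      using card by (metis UNIV_I UNIV_eq_I card_1_singleton_iff One_nat_def singletonD singletonI)
    obtain e where e: "T (unit_vec a + \<i> *s unit_vec b) = e *s (unit_vec a + \<i> *s unit_vec b)"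
      using eigen by blast
    have eq: "(g *s unit_vec a + cnj \<i> *s (g *s unit_vec b)) $ k =
        (e *s (unit_vec a + \<i> *s unit_vec b)) $ k" for k
      using e add[of "unit_vec a" "\<i> *s unit_vec b"] by (simp add: conj unit)
    have "g = e" "- g = e"
      using eq[of a] eq[of b] \<open>b \<noteq> a\<close> by (auto simp: axis_def complex_eq_iff)
    thus False using g(1) by auto
  qed
  hence "Vector_Spaces.linear (*s) (*s) T"
    unfolding Vector_Spaces.linear_iff by (simp add: vec.vector_space_axioms add)
  hence T: "T x = matrix T *v x" for x by (simp add: matrix_works)
  have "T x = g *s x" for x
  proof -
    have "matrix T $ i $ j = (if i = j then g else 0)" for i j
      using unit[of j] by (simp add: matrix_def axis_def)
    thus ?thesis
      by (subst T) (simp add: vec_eq_iff matrix_vector_mult_def if_distrib[of "\<lambda>z. z * _"] cong: if_cong)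
  qed
  thus ?thesis using g(1) by blast
qed

text \<open>Both conjugations agree on \<open>outer (T x)\<close> for \<open>T\<close> the composite
  of \<open>V\<close> with \<open>inv U\<close>, so \<open>inv U (T x)\<close> and
  \<open>inv U x\<close> have the same rank-one matrix. Hence \<open>T\<close> maps each vector to a
  unimodular multiple of itself.\<close>

lemma isometric_op_unique_up_to_phase:
  assumes U: "isometric_op U" and h: "\<And>G. G \<in> hermitians \<Longrightarrow> h G = dagger_conj U G"
  shows "unique_up_to_phase h U"
  unfolding unique_up_to_phase_def
proof (intro allI impI, elim conjE)
  fix V :: "complex^'a \<Rightarrow> complex^'a"
  assume "unitary_op V \<or> antiunitary_op V" and hV: "\<forall>G\<in>hermitians. h G = dagger_conj V G"
    and card: "CARD('a) = 1 \<longrightarrow> (unitary_op V \<longleftrightarrow> unitary_op U)"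
  hence V: "isometric_op V" by (simp add: isometric_op_def)
  define T where "T = (\<lambda>x. V (inv U x))"
  have "\<exists>c. cmod c = 1 \<and> (\<forall>x. T x = c *s x)"
  proof (rule additive_eigenvectors_scalar)
    show "T (x + y) = T x + T y" for x y
      by (simp add: T_def isometric_op_add U V isometric_op_inv)
    show "\<exists>c. cmod c = 1 \<and> T x = c *s x" for x
    proof -
      have "outer (inv U (T x)) = outer (inv V (T x))"
        using h[OF outer_hermitian] hV outer_hermitian
        by (metis dagger_conj_outer[OF U] dagger_conj_outer[OF V])
      hence "outer (inv U (T x)) = outer (inv U x)"
        by (simp add: T_def V)
      then obtain c where c: "cmod c = 1" "inv U (T x) = c *s inv U x"
        by (rule outer_eq_imp_unimodular_multiple)
      have "T x = U (c *s inv U x)"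
        using c(2) isometric_op_inv_right[OF U] by metis
      thus ?thesis
        using U c(1) unfolding isometric_op_def
        by (metis antiunitary_op_scale unitary_op_scale isometric_op_inv_right[OF U] complex_mod_cnj)
    qed
    show "(\<forall>c x. T (c *s x) = c *s T x) \<or> CARD('a) \<noteq> 1 \<and> (\<forall>c x. T (c *s x) = cnj c *s T x)"
    proof (cases "unitary_op U \<longleftrightarrow> unitary_op V")
      case True
      hence "T (c *s x) = c *s T x" for c x
        using U V unitary_op_inv[of U] antiunitary_op_inv[of U]
        by (cases "unitary_op U")
          (auto simp: T_def isometric_op_def unitary_op_scale antiunitary_op_scale)
      thus ?thesis by blast
    next
      case False
      hence "T (c *s x) = cnj c *s T x" for c x
        using U V unitary_op_inv[of U] antiunitary_op_inv[of U]
        by (cases "unitary_op U")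
          (auto simp: T_def isometric_op_def unitary_op_scale antiunitary_op_scale)
      thus ?thesis using False card by blast
    qed
  qed
  then obtain c where c: "cmod c = 1" "\<And>x. T x = c *s x" by blast
  have "V x = c *s U x" for x
    using c(2)[of "U x"] by (simp add: T_def U)
  thus "\<exists>c. cmod c = 1 \<and> (\<forall>x. V x = c *s U x)" using c(1) by blast
qed

theorem theoremA9:
  fixes h :: "complex^'n^'n \<Rightarrow> complex^'n^'n"
  assumes "temporal_coherent h"
  shows "\<exists>U. (unitary_op U \<or> antiunitary_op U) \<and>
             (\<forall>G\<in>hermitians. h G = dagger_conj U G) \<and>
             unique_up_to_phase h U \<and>
             (\<forall>K. SDG K \<longrightarrow> SDG {G \<in> hermitians. dagger_conj U G \<in> K})"
proof -
  obtain H where "psd_automorphism H" and H: "\<And>G. G \<in> hermitians \<Longrightarrow> H G = h G"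
    using temporal_coherent_linear[OF assms] by blast
  then obtain U where U: "isometric_op U" "\<And>G. G \<in> hermitians \<Longrightarrow> h G = dagger_conj U G"
    using psd_automorphism.exists_isometric_op[OF \<open>psd_automorphism H\<close>] by auto
  show ?thesis
    using U isometric_op_unique_up_to_phase[OF U] SDG_dagger_conj[OF U(1)]
    unfolding isometric_op_def by blast
qed

end
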